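(* There is an absolute constant $C>0$ such that the following holds. Let $A$ be an $m\times n$ matrix with $m>n$, all entries in $[-1,1]$, and no zero column. Let $\epsilon>0$ and let $\gamma\ge C\,n/\epsilon^2$ (with $\gamma\ge 1$). Let $B$ be the $n\times n$ output of DIMSUM run on $A$ with parameter $\gamma$, and let $D$ be the $n\times n$ diagonal matrix with $d_{ii}=\|c_i\|$. Then, with probability at least $1/2$, $$\frac{\|DBD-A^TA\|_2}{\|A^TA\|_2}\le \epsilon,$$ where $\|\cdot\|_2$ denotes the spectral norm.
   Context: Let $A=(a_{ki})$ be an $m\times n$ real matrix with rows $r_1,\dots,r_m$ and columns $c_1,\dots,c_n$; $\|c_i\|$ is the Euclidean norm of column $i$ (assumed nonzero). DIMSUM with parameter $\gamma>0$ is the following randomized procedure. For each pair of column indices $(i,j)$ set $p_{ij}=\min\!\left(1,\frac{\gamma}{\|c_i\|\|c_j\|}\right)$. For each row $k$ and each pair $(i,j)$ with $a_{ki}a_{kj}\neq 0$, independently (over all $k$ and all pairs) with probability $p_{ij}$ the value $a_{ki}a_{kj}$ is emitted to key $(i,j)$ (one "emission"); equivalently let $X_{ijk}$ equal $a_{ki}a_{kj}$ with probability $p_{ij}$ and $0$ otherwise. The output is the $n\times n$ matrix $B$ with $b_{ij}=\frac{1}{\gamma}\sum_{k=1}^m X_{ijk}$ if $\frac{\gamma}{\|c_i\|\|c_j\|}\le 1$, and $b_{ij}=\frac{1}{\|c_i\|\|c_j\|}\sum_{k=1}^m X_{ijk}$ otherwise. Thus $\mathbb{E}[b_{ij}]=\frac{c_i^Tc_j}{\|c_i\|\|c_j\|}$.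 *)

theory Defs
  imports "HOL-Probability.Probability"
begin

text \<open>Matrices are functions nat => nat => real; an m x n matrix A has entries A k i
  for k < m (row), i < n (column). Entries outside the index range are irrelevant.\<close>

definition col_norm :: "nat \<Rightarrow> (nat \<Rightarrow> nat \<Rightarrow> real) \<Rightarrow> nat \<Rightarrow> real" where
  "col_norm m A i = sqrt (\<Sum>k<m. (A k i)\<^sup>2)"

definition gram :: "nat \<Rightarrow> (nat \<Rightarrow> nat \<Rightarrow> real) \<Rightarrow> nat \<Rightarrow> nat \<Rightarrow> real" where
  "gram m A i j = (\<Sum>k<m. A k i * A k j)"

definition spec_norm :: "nat \<Rightarrow> (nat \<Rightarrow> nat \<Rightarrow> real) \<Rightarrow> real" where
  "spec_norm n M = Sup {sqrt (\<Sum>i<n. (\<Sum>j<n. M i j * x j)\<^sup>2) | x. (\<Sum>j<n. (x j)\<^sup>2) \<le> 1}"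

definition dimsum_p :: "nat \<Rightarrow> (nat \<Rightarrow> nat \<Rightarrow> real) \<Rightarrow> real \<Rightarrow> nat \<Rightarrow> nat \<Rightarrow> real" where
  "dimsum_p m A \<gamma> i j = min 1 (\<gamma> / (col_norm m A i * col_norm m A j))"

text \<open>The random coin flips: \<omega> (k,i,j) = True iff the product a_ki a_kj is emitted
  to key (i,j). All coins are independent, coin (k,i,j) has success probability p_ij.\<close>
definition dimsum_coins :: "nat \<Rightarrow> nat \<Rightarrow> (nat \<Rightarrow> nat \<Rightarrow> real) \<Rightarrow> real \<Rightarrow> (nat \<times> nat \<times> nat \<Rightarrow> bool) pmf" where
  "dimsum_coins m n A \<gamma> =
     Pi_pmf {(k, i, j). k < m \<and> i < n \<and> j < n} False
       (\<lambda>(k, i, j). bernoulli_pmf (dimsum_p m A \<gamma> i j))"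

definition dimsum_X :: "(nat \<Rightarrow> nat \<Rightarrow> real) \<Rightarrow> (nat \<times> nat \<times> nat \<Rightarrow> bool) \<Rightarrow> nat \<Rightarrow> nat \<Rightarrow> nat \<Rightarrow> real" where
  "dimsum_X A \<omega> i j k = (if \<omega> (k, i, j) then A k i * A k j else 0)"

definition dimsum_B :: "nat \<Rightarrow> (nat \<Rightarrow> nat \<Rightarrow> real) \<Rightarrow> real \<Rightarrow> (nat \<times> nat \<times> nat \<Rightarrow> bool) \<Rightarrow> nat \<Rightarrow> nat \<Rightarrow> real" where
  "dimsum_B m A \<gamma> \<omega> i j =
     (if \<gamma> / (col_norm m A i * col_norm m A j) \<le> 1
      then (1 / \<gamma>) * (\<Sum>k<m. dimsum_X A \<omega> i j k)
      else (1 / (col_norm m A i * col_norm m A j)) * (\<Sum>k<m. dimsum_X A \<omega> i j k))"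

definition DBD :: "nat \<Rightarrow> (nat \<Rightarrow> nat \<Rightarrow> real) \<Rightarrow> real \<Rightarrow> (nat \<times> nat \<times> nat \<Rightarrow> bool) \<Rightarrow> nat \<Rightarrow> nat \<Rightarrow> real" where
  "DBD m A \<gamma> \<omega> i j = col_norm m A i * dimsum_B m A \<gamma> \<omega> i j * col_norm m A j"

end

theory Submission
  imports Defs
begin

text \<open>
  The error matrix \<open>E = DBD - A\<^sup>T A\<close> has independent centred entries which, after division by
  \<open>\<parallel>A\<^sup>T A\<parallel> / \<gamma>\<close>, are sums of independent centred Bernoulli variables with weights at most \<open>1\<close> and
  total variance at most \<open>\<gamma>\<close>. It remains to bound the norm of such a matrix by \<open>O(sqrt (n \<gamma>))\<close>;
  since individual entries are only subexponential, a union bound over a net of the sphere fails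
  for test vectors with large coordinates.

  Instead, scale the test vectors by \<open>sqrt n\<close> and round each coordinate to \<open>0\<close> or \<open>\<plusminus>2\<^sup>j\<close>, which is
  free because a bilinear form is affine in each coordinate. Writing \<open>x\<^bsub>=k\<^esub>\<close>, \<open>x\<^bsub>\<ge>k\<^esub>\<close>, \<open>x\<^bsub>>k\<^esub>\<close> for the
  parts of \<open>x\<close> with coordinates of modulus \<open>= 2\<^sup>k\<close>, \<open>\<ge> 2\<^sup>k\<close>, \<open>> 2\<^sup>k\<close>, one has
  \<open>x\<^sup>T E y = \<Sum>\<^sub>k (x\<^bsub>\<ge>k\<^esub>\<^sup>T E y\<^bsub>=k\<^esub> + x\<^bsub>=k\<^esub>\<^sup>T E y\<^bsub>>k\<^esub>)\<close>. At level \<open>k\<close> the products of coordinates are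
  \<open>O(2\<^sup>k sqrt n)\<close>, and only \<open>exp (O(n (k + 1) / 4\<^sup>k))\<close> vectors occur, so a Chernoff bound with
  parameter of order \<open>1 / (2\<^sup>k sqrt (n \<gamma>))\<close> and a union bound control level \<open>k\<close> by
  \<open>O(n sqrt (n \<gamma>) (k + 1) / 2\<^sup>k)\<close>, which is summable over \<open>k\<close>.
\<close>

subsection \<open>Sums of independent Bernoulli variables\<close>

lemma exp_le_quadratic:
  fixes x :: real
  assumes "\<bar>x\<bar> \<le> 1"
  shows "exp x \<le> 1 + x + x\<^sup>2"
proof (cases "x \<ge> 0")
  case True
  then show ?thesis using assms exp_bound by auto
next
  case False
  define y where "y = - x"
  have y: "y > 0" using False by (simp add: y_def)
  \<comment> \<open>The product equals 1 + y^3, so it is at least 1. Replacing 1 + y by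
    \<open>exp y\<close> and dividing gives the bound for \<open>exp (- y)\<close>.\<close>
  have "1 * exp 0 \<le> (1 - y + y\<^sup>2) * (1 + y)"
    using y by (simp add: algebra_simps power2_eq_square)
  also have "\<dots> \<le> (1 - y + y\<^sup>2) * exp y"
  proof (rule mult_left_mono)
    have "0 \<le> (y - 1/2)\<^sup>2 + 3/4" by simp
    also have "\<dots> = 1 - y + y\<^sup>2" by (simp add: power2_eq_square algebra_simps)
    finally show "0 \<le> 1 - y + y\<^sup>2" .
  qed simp
  finally have "exp (- y) \<le> 1 - y + y\<^sup>2"
    by (simp add: exp_minus field_simps)
  then show ?thesis by (simp add: y_def)
qed

text \<open>In the quadratic bound for exp the linear terms cancel and the quadratic ones add up to
  the variance. At p = 1 the centred variable vanishes, so \<open>s\<close> is left unrestricted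
  there; the DIMSUM weights obey a bound only for pairs with p < 1.\<close>

lemma bernoulli_mgf_le:
  fixes p s :: real
  assumes p: "0 \<le> p" "p \<le> 1" and s: "p < 1 \<Longrightarrow> \<bar>s\<bar> \<le> 1"
  shows "measure_pmf.expectation (bernoulli_pmf p) (\<lambda>b. exp (s * (of_bool b - p)))
           \<le> exp (s\<^sup>2 * p * (1 - p))"
proof (cases "p < 1")
  case False
  then have "p = 1" using p by simp
  then show ?thesis using p by simp
next
  case True
  have a: "\<bar>s * (1 - p)\<bar> \<le> 1" "\<bar>- (s * p)\<bar> \<le> 1"
    using s[OF True] p by (auto simp: abs_mult intro: mult_le_one)
  have "measure_pmf.expectation (bernoulli_pmf p) (\<lambda>b. exp (s * (of_bool b - p)))
      = p * exp (s * (1 - p)) + (1 - p) * exp (- (s * p))"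
    using p by simp
  also have "\<dots> \<le> p * (1 + s * (1 - p) + (s * (1 - p))\<^sup>2) + (1 - p) * (1 + - (s * p) + (- (s * p))\<^sup>2)"
    using p by (intro add_mono mult_left_mono exp_le_quadratic a) auto
  also have "\<dots> = 1 + s\<^sup>2 * p * (1 - p)"
    by (simp add: power2_eq_square algebra_simps)
  also have "\<dots> \<le> exp (s\<^sup>2 * p * (1 - p))" by (rule exp_ge_add_one_self)
  finally show ?thesis .
qed

text \<open>A Chernoff bound whose exponential parameter is fixed to 1: callers absorb the parameter
  into the weights, so the exponent is just variance minus threshold.\<close>

lemma bernoulli_sum_tail:
  fixes p w :: "'a \<Rightarrow> real"
  assumes I: "finite I"
    and p: "\<And>i. i \<in> I \<Longrightarrow> 0 \<le> p i \<and> p i \<le> 1"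
    and w: "\<And>i. i \<in> I \<Longrightarrow> p i < 1 \<Longrightarrow> \<bar>w i\<bar> \<le> 1"
  shows "measure_pmf.prob (Pi_pmf I False (\<lambda>i. bernoulli_pmf (p i)))
            {\<omega>. t \<le> (\<Sum>i\<in>I. w i * (of_bool (\<omega> i) - p i))}
         \<le> exp ((\<Sum>i\<in>I. (w i)\<^sup>2 * p i * (1 - p i)) - t)"
proof -
  let ?P = "Pi_pmf I False (\<lambda>i. bernoulli_pmf (p i))"
  let ?S = "\<lambda>\<omega>. \<Sum>i\<in>I. w i * (of_bool (\<omega> i) - p i)"
  have eq: "exp (?S \<omega>) = (\<Prod>i\<in>I. exp (w i * (of_bool (\<omega> i) - p i)))" for \<omega>
    by (simp add: exp_sum I)
  have int: "integrable (measure_pmf ?P) (\<lambda>\<omega>. exp (?S \<omega>))"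
    unfolding eq by (rule integrable_prod_Pi_pmf) (auto simp: I intro: integrable_measure_pmf_finite)
  have "measure_pmf.prob ?P {\<omega>. t \<le> ?S \<omega>}
      = measure_pmf.prob ?P {\<omega>\<in>space (measure_pmf ?P). exp t \<le> exp (?S \<omega>)}"
    by simp
  also have "\<dots> \<le> measure_pmf.expectation ?P (\<lambda>\<omega>. exp (?S \<omega>)) / exp t"
    by (rule integral_Markov_inequality_measure[where A="{}"]) (use int in auto)
  also have "measure_pmf.expectation ?P (\<lambda>\<omega>. exp (?S \<omega>))
      = (\<Prod>i\<in>I. measure_pmf.expectation (bernoulli_pmf (p i)) (\<lambda>b. exp (w i * (of_bool b - p i))))"
    unfolding eq
    by (rule expectation_prod_Pi_pmf) (auto simp: I intro: integrable_measure_pmf_finite)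
  also have "\<dots> \<le> (\<Prod>i\<in>I. exp ((w i)\<^sup>2 * p i * (1 - p i)))"
    by (intro prod_mono conjI bernoulli_mgf_le) (use p w in auto)
  also have "\<dots> = exp (\<Sum>i\<in>I. (w i)\<^sup>2 * p i * (1 - p i))"
    by (simp add: exp_sum I)
  finally show ?thesis by (simp add: exp_diff divide_right_mono)
qed

subsection \<open>Dyadic vectors\<close>

definition dyadic :: "nat \<Rightarrow> nat \<Rightarrow> real set" where
  "dyadic k K = insert 0 ((\<lambda>j. 2 ^ j) ` {k..K} \<union> (\<lambda>j. - (2 ^ j)) ` {k..K})"

text \<open>The constant 5 is the price of rounding: a coordinate s is replaced by one with square
  at most 4 s^2 + 1, and the squares of the s sum to at most n. Extensional functions make the set
  finite.\<close>

definition dyadic_vecs :: "nat \<Rightarrow> nat \<Rightarrow> nat \<Rightarrow> (nat \<Rightarrow> real) set" where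
  "dyadic_vecs n K k = {x \<in> {..<n} \<rightarrow>\<^sub>E dyadic k K. (\<Sum>i<n. (x i)\<^sup>2) \<le> 5 * real n}"

lemma finite_dyadic: "finite (dyadic k K)"
  by (simp add: dyadic_def)

lemma finite_dyadic_vecs: "finite (dyadic_vecs n K k)"
  unfolding dyadic_vecs_def by (simp add: finite_PiE finite_dyadic)

lemma exp_minus_le_quarter_power: "exp (- (2 * real m)) \<le> (1/4) ^ m"
proof -
  have "(4::real) \<le> exp 2"
    using exp_lower_Taylor_quadratic[of 2] by simp
  then have "(4::real) ^ m \<le> exp 2 ^ m" by (rule power_mono) simp
  also have "\<dots> = exp (2 * real m)" by (simp add: exp_of_nat_mult mult.commute)
  finally show ?thesis
    by (simp add: exp_minus power_one_over field_simps)
qed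

lemma sum_quarter_power: "(\<Sum>j=k..K. (1/4::real) ^ Suc j) \<le> (1/4) ^ k / 2"
proof (cases "k \<le> K")
  case True
  have "(\<Sum>j=k..K. (1/4::real) ^ Suc j) = ((1/4) ^ k - (1/4) ^ Suc K) / 3"
    using True by (induction K rule: dec_induct) auto
  also have "\<dots> \<le> (1/4) ^ k / 2"
    by (simp add: field_simps)
  finally show ?thesis .
qed auto

text \<open>The rate is tuned so that the entry 2^j with j = k + i has exponent -2 (k + 1) 4^i,
  which is at most -2 (j + 1). Each such term is then at most 4^-(j + 1), and both signs together
  add at most 4^-k to the term 1 of the entry 0.\<close>

lemma dyadic_gaussian_sum_le:
  "(\<Sum>a\<in>dyadic k K. exp (- (2 * real (k + 1) / 4 ^ k) * a\<^sup>2)) \<le> exp ((1/4) ^ k)"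
proof -
  let ?f = "\<lambda>a::real. exp (- (2 * real (k + 1) / 4 ^ k) * a\<^sup>2)"
  have small: "?f (2 ^ j) \<le> (1/4) ^ Suc j" if kj: "k \<le> j" for j
  proof -
    obtain i where j: "j = k + i" using le_Suc_ex[OF kj] by blast
    have "(1 + real i) \<le> 4 ^ i" using Bernoulli_inequality[of "3::real" i] by simp
    then have "real (k + 1) * (1 + real i) \<le> real (k + 1) * 4 ^ i" 
      by (intro mult_left_mono) auto
    moreover have "real (Suc j) \<le> real (k + 1) * (1 + real i)"
      by (simp add: j algebra_simps)
    ultimately have *: "real (Suc j) \<le> real (k + 1) * 4 ^ i" by linarith
    have "(2 * real (k + 1) / 4 ^ k) * (2 ^ j)\<^sup>2 = 2 * (real (k + 1) * 4 ^ i)"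
    proof -
      have "((2::real) ^ j)\<^sup>2 = (2\<^sup>2) ^ j"
        by (simp only: mult.commute flip: power_mult)
      then have "((2::real) ^ j)\<^sup>2 = 4 ^ k * 4 ^ i" by (simp add: j power_add)
      then show ?thesis by simp
    qed
    then have "?f (2 ^ j) = exp (- (2 * (real (k + 1) * 4 ^ i)))" by simp
    also have "\<dots> \<le> exp (- (2 * real (Suc j)))" using * by simp
    also have "\<dots> \<le> (1/4) ^ Suc j" by (rule exp_minus_le_quarter_power)
    finally show ?thesis .
  qed
  have "(\<Sum>a\<in>dyadic k K. ?f a)
      \<le> ?f 0 + ((\<Sum>a\<in>(\<lambda>j. 2 ^ j) ` {k..K}. ?f a) + (\<Sum>a\<in>(\<lambda>j. - (2 ^ j)) ` {k..K}. ?f a))"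
  proof -
    have "sum ?f (insert 0 (P \<union> N)) \<le> ?f 0 + (sum ?f P + sum ?f N)"
      if "finite P" "finite N" for P N
    proof -
      have "sum ?f (insert 0 (P \<union> N)) \<le> ?f 0 + sum ?f (P \<union> N)"
        using that by (simp add: sum.insert_if)
      moreover have "sum ?f (P \<union> N) \<le> sum ?f P + sum ?f N"
        using sum.union_inter[OF that, of ?f] sum_nonneg[of "P \<inter> N" ?f] by simp
      ultimately show ?thesis by linarith
    qed
    then show ?thesis unfolding dyadic_def by simp
  qed
  also have "\<dots> \<le> 1 + ((\<Sum>j=k..K. ?f (2 ^ j)) + (\<Sum>j=k..K. ?f (- (2 ^ j))))"
    by (intro add_mono sum_image_le[unfolded comp_def]) auto
  also have "\<dots> = 1 + 2 * (\<Sum>j=k..K. ?f (2 ^ j))" by simp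
  also have "\<dots> \<le> 1 + 2 * (\<Sum>j=k..K. (1/4) ^ Suc j)"
    by (intro add_left_mono mult_left_mono sum_mono small) auto
  also have "\<dots> \<le> 1 + (1/4) ^ k" using sum_quarter_power[of k K] by linarith
  also have "\<dots> \<le> exp ((1/4) ^ k)" by (rule exp_ge_add_one_self)
  finally show ?thesis .
qed

lemma card_dyadic_vecs_le:
  "real (card (dyadic_vecs n K k)) \<le> exp (11 * real n * real (k + 1) / 4 ^ k)"
proof -
  let ?V = "{..<n} \<rightarrow>\<^sub>E dyadic k K"
  define \<theta> where "\<theta> = 2 * real (k + 1) / 4 ^ k"
  have \<theta>: "\<theta> \<ge> 0" by (simp add: \<theta>_def)
  txt \<open>Exponential Markov inequality for the counting measure.\<close>
  have "real (card (dyadic_vecs n K k)) = (\<Sum>x\<in>dyadic_vecs n K k. 1)" by simp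
  also have "\<dots> \<le> (\<Sum>x\<in>dyadic_vecs n K k. exp (\<theta> * (5 * real n - (\<Sum>i<n. (x i)\<^sup>2))))"
    by (intro sum_mono) (auto simp: dyadic_vecs_def \<theta>)
  also have "\<dots> \<le> (\<Sum>x\<in>?V. exp (\<theta> * (5 * real n - (\<Sum>i<n. (x i)\<^sup>2))))"
    by (intro sum_mono2) (auto simp: dyadic_vecs_def finite_PiE finite_dyadic)
  also have "\<dots> = exp (5 * real n * \<theta>) * (\<Sum>x\<in>?V. \<Prod>i<n. exp (- \<theta> * (x i)\<^sup>2))"
    by (simp add: sum_distrib_left algebra_simps sum_negf flip: exp_sum exp_add)
  also have "(\<Sum>x\<in>?V. \<Prod>i<n. exp (- \<theta> * (x i)\<^sup>2)) = (\<Prod>i<n. \<Sum>a\<in>dyadic k K. exp (- \<theta> * a\<^sup>2))"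
    by (rule prod_sum_PiE[symmetric]) (auto simp: finite_dyadic)
  also have "\<dots> \<le> (\<Prod>i<n. exp ((1/4) ^ k))"
    using dyadic_gaussian_sum_le[of k K] unfolding \<theta>_def
    by (intro prod_mono) (auto intro: sum_nonneg)
  also have "\<dots> = exp (real n * (1/4) ^ k)" by (simp add: exp_of_nat_mult)
  \<comment> \<open>11 = 5 * 2 + 1: the first part comes from 5 n times \<open>\<theta>\<close>, the
    last from n / 4^k <= n (k + 1) / 4^k.\<close>
  also have "exp (5 * real n * \<theta>) * \<dots> \<le> exp (11 * real n * real (k + 1) / 4 ^ k)"
    by (simp add: \<theta>_def power_one_over field_simps flip: exp_add)
  finally show ?thesis by simp
qed

section \<open>Splitting products by level, and rounding to dyadic coordinates\<close>

lemma dyadic_cases: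
  assumes "a \<in> dyadic k K"
  obtains "a = 0" | p where "k \<le> p" "p \<le> K" "\<bar>a\<bar> = 2 ^ p"
  using assms by (auto simp: dyadic_def)

lemma dyadicI: "\<bar>a\<bar> = 2 ^ p \<Longrightarrow> k \<le> p \<Longrightarrow> p \<le> K \<Longrightarrow> a \<in> dyadic k K"
  by (cases "a \<ge> 0") (auto simp: dyadic_def image_iff Bex_def intro!: exI[of _ p])

lemma zero_in_dyadic [simp]: "0 \<in> dyadic k K"
  by (simp add: dyadic_def)

lemma dyadic_minus: "a \<in> dyadic k K \<Longrightarrow> - a \<in> dyadic k K"
  by (erule dyadic_cases) (auto intro: dyadicI)

text \<open>For moduli 2^p and 2^q only the level k = min p q contributes. The first summand catches
  q <= p and the second p < q, so the non-strict and strict comparisons count a tie exactly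
  once.\<close>

lemma dyadic_product_split:
  assumes a: "a \<in> dyadic 0 K" and b: "b \<in> dyadic 0 K"
  shows "a * b = (\<Sum>k\<le>K. (if 2 ^ k \<le> \<bar>a\<bar> then a else 0) * (if \<bar>b\<bar> = 2 ^ k then b else 0)
                        + (if \<bar>a\<bar> = 2 ^ k then a else 0) * (if 2 ^ k < \<bar>b\<bar> then b else 0))"
proof (cases "a = 0 \<or> b = 0")
  case True
  then show ?thesis by auto
next
  case False
  obtain p where p: "p \<le> K" "\<bar>a\<bar> = 2 ^ p" using a False by (auto elim: dyadic_cases)
  obtain q where q: "q \<le> K" "\<bar>b\<bar> = 2 ^ q" using b False by (auto elim: dyadic_cases)
  have "(\<Sum>k\<le>K. (if 2 ^ k \<le> \<bar>a\<bar> then a else 0) * (if \<bar>b\<bar> = 2 ^ k then b else 0)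
                        + (if \<bar>a\<bar> = 2 ^ k then a else 0) * (if 2 ^ k < \<bar>b\<bar> then b else 0))
      = (\<Sum>k\<le>K. if k = min p q then a * b else 0)"
    by (rule sum.cong) (auto simp: p q min_def)
  also have "\<dots> = a * b" using p q by simp
  finally show ?thesis by simp
qed

text \<open>The upper neighbour is the least power 2^j >= s. If j > 0, then 2^(j - 1) <= s serves as
  lower neighbour and 2^j <= 2 s. If j = 0, the neighbours are 0 and 1, which the summand 1 in the
  bound covers.\<close>

lemma dyadic_neighbours_nonneg:
  fixes s :: real
  assumes s: "0 \<le> s" "s \<le> 2 ^ K"
  obtains a b where "a \<in> dyadic 0 K" "b \<in> dyadic 0 K" "a \<le> s" "s \<le> b"
    "a\<^sup>2 \<le> 4 * s\<^sup>2 + 1" "b\<^sup>2 \<le> 4 * s\<^sup>2 + 1"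
proof -
  define j where "j = (LEAST j. s \<le> 2 ^ j)"
  have j: "s \<le> 2 ^ j" unfolding j_def using s(2) by (rule LeastI)
  have jK: "j \<le> K" unfolding j_def using s(2) by (rule Least_le)
  show ?thesis
  proof (cases j)
    case 0
    show ?thesis
      by (rule that[of 0 "2 ^ j"]) (use 0 j s jK in \<open>auto intro: dyadicI[where p = j]\<close>)
  next
    case (Suc i)
    have "\<not> s \<le> 2 ^ i" using not_less_Least[of i "\<lambda>j. s \<le> 2 ^ j"] Suc unfolding j_def by simp
    then have i: "2 ^ i \<le> s" by simp
    have "(2 ^ i)\<^sup>2 \<le> s\<^sup>2" using i by (intro power_mono) auto
    then have "(2 ^ i)\<^sup>2 \<le> 4 * s\<^sup>2 + 1" "(2 ^ j)\<^sup>2 \<le> 4 * s\<^sup>2 + 1"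
      using zero_le_power2[of s] by (simp_all only: Suc power_Suc power_mult_distrib power2_eq_square)
    then show ?thesis
      by (intro that[of "2 ^ i" "2 ^ j"])
        (use Suc i j s jK in \<open>auto intro: dyadicI[where p = j] dyadicI[where p = i]\<close>)
  qed
qed

lemma dyadic_neighbours:
  fixes s :: real
  assumes s: "\<bar>s\<bar> \<le> 2 ^ K"
  obtains a b where "a \<in> dyadic 0 K" "b \<in> dyadic 0 K" "a \<le> s" "s \<le> b"
    "a\<^sup>2 \<le> 4 * s\<^sup>2 + 1" "b\<^sup>2 \<le> 4 * s\<^sup>2 + 1"
proof (cases "s \<ge> 0")
  case True
  then show ?thesis using s dyadic_neighbours_nonneg[of s K] that by auto
next
  case False
  then obtain a b where "a \<in> dyadic 0 K" "b \<in> dyadic 0 K" "a \<le> - s" "- s \<le> b"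
    "a\<^sup>2 \<le> 4 * (- s)\<^sup>2 + 1" "b\<^sup>2 \<le> 4 * (- s)\<^sup>2 + 1"
    using s dyadic_neighbours_nonneg[of "- s" K] by auto
  then show ?thesis by (intro that[of "- b" "- a"]) (auto intro: dyadic_minus)
qed

text \<open>A linear function on an interval is maximal at an endpoint, so each coordinate moves to
  its upper or lower dyadic neighbour according to the sign of its coefficient. The value never
  drops, hence there is no approximation error to control.\<close>

lemma linear_form_rounding:
  fixes s g :: "nat \<Rightarrow> real"
  assumes s: "(\<Sum>i<n. (s i)\<^sup>2) \<le> real n" and K: "real n \<le> 4 ^ K"
  obtains x where "x \<in> dyadic_vecs n K 0" "(\<Sum>i<n. s i * g i) \<le> (\<Sum>i<n. x i * g i)"
proof -
  have "\<exists>a \<in> dyadic 0 K. a\<^sup>2 \<le> 4 * (s i)\<^sup>2 + 1 \<and> s i * g i \<le> a * g i" if i: "i < n" for i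
  proof -
    have "(s i)\<^sup>2 \<le> (\<Sum>i<n. (s i)\<^sup>2)"
      using i by (intro member_le_sum) auto
    also have "\<dots> \<le> 4 ^ K" using s K by linarith
    also have "(4::real) ^ K = (2 ^ K)\<^sup>2"
      by (simp add: power2_eq_square flip: power_mult_distrib)
    finally have "\<bar>s i\<bar> \<le> 2 ^ K" by (simp add: abs_le_square_iff[symmetric])
    then obtain a b where ab: "a \<in> dyadic 0 K" "b \<in> dyadic 0 K" "a \<le> s i" "s i \<le> b"
      "a\<^sup>2 \<le> 4 * (s i)\<^sup>2 + 1" "b\<^sup>2 \<le> 4 * (s i)\<^sup>2 + 1"
      by (rule dyadic_neighbours)
    show ?thesis
      using ab mult_right_mono[of "s i" b "g i"] mult_right_mono_neg[of a "s i" "g i"]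
      by (cases "g i \<ge> 0") auto
  qed
  then obtain f where f: "\<And>i. i < n \<Longrightarrow> f i \<in> dyadic 0 K"
    "\<And>i. i < n \<Longrightarrow> (f i)\<^sup>2 \<le> 4 * (s i)\<^sup>2 + 1" "\<And>i. i < n \<Longrightarrow> s i * g i \<le> f i * g i"
    by metis
  have "(\<Sum>i<n. (f i)\<^sup>2) \<le> (\<Sum>i<n. 4 * (s i)\<^sup>2 + 1)" using f by (intro sum_mono) auto
  also have "\<dots> = 4 * (\<Sum>i<n. (s i)\<^sup>2) + n" by (simp add: sum.distrib sum_distrib_left)
  also have "\<dots> \<le> 5 * real n" using s by simp
  finally have "restrict f {..<n} \<in> dyadic_vecs n K 0"
    using f by (auto simp: dyadic_vecs_def)
  moreover have "(\<Sum>i<n. s i * g i) \<le> (\<Sum>i<n. restrict f {..<n} i * g i)"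
    using f by (intro sum_mono) auto
  ultimately show ?thesis by (rule that)
qed

definition bilin :: "nat \<Rightarrow> (nat \<Rightarrow> nat \<Rightarrow> real) \<Rightarrow> (nat \<Rightarrow> real) \<Rightarrow> (nat \<Rightarrow> real) \<Rightarrow> real" where
  "bilin n E x y = (\<Sum>i<n. \<Sum>j<n. x i * y j * E i j)"

lemma bilin_swap: "bilin n E x y = bilin n (\<lambda>i j. E j i) y x"
  unfolding bilin_def by (subst sum.swap) (simp add: mult.commute)

lemma bilin_rounding_left:
  assumes "(\<Sum>i<n. (s i)\<^sup>2) \<le> real n" "real n \<le> 4 ^ K"
  obtains x where "x \<in> dyadic_vecs n K 0" "bilin n E s y \<le> bilin n E x y"
proof -
  have eq: "bilin n E z y = (\<Sum>i<n. z i * (\<Sum>j<n. y j * E i j))" for z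
    by (simp add: bilin_def sum_distrib_left mult.assoc)
  show ?thesis
    using linear_form_rounding[OF assms, of "\<lambda>i. \<Sum>j<n. y j * E i j"] that
    unfolding eq by blast
qed

lemma bilin_rounding:
  assumes "(\<Sum>i<n. (s i)\<^sup>2) \<le> real n" "(\<Sum>i<n. (t i)\<^sup>2) \<le> real n" "real n \<le> 4 ^ K"
  obtains x y where "x \<in> dyadic_vecs n K 0" "y \<in> dyadic_vecs n K 0"
    "bilin n E s t \<le> bilin n E x y"
proof -
  obtain x where x: "x \<in> dyadic_vecs n K 0" "bilin n E s t \<le> bilin n E x t"
    using assms(1,3) by (rule bilin_rounding_left)
  obtain y where "y \<in> dyadic_vecs n K 0" "bilin n E x t \<le> bilin n E x y"
    using assms(2,3) bilin_rounding_left[of t n K "\<lambda>i j. E j i" x] by (metis bilin_swap)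
  with x show ?thesis using that by force
qed

section \<open>Reduction of bilinear forms to balanced pairs\<close>

lemma sum_Suc_half_power: "(\<Sum>k\<le>K. real (k + 1) / 2 ^ k) \<le> 4"
proof -
  have "(\<Sum>k\<le>K. real (k + 1) / 2 ^ k) = 4 - (real K + 3) / 2 ^ K"
    by (induction K) (auto simp: field_simps)
  then show ?thesis by simp
qed

text \<open>\<open>P\<close> stands for any of the three truncations: modulus at least, equal to, or
  above 2^k.\<close>

lemma dyadic_vecs_restrict:
  assumes x: "x \<in> dyadic_vecs n K 0" and P: "\<And>a. P a \<Longrightarrow> 2 ^ k \<le> \<bar>a\<bar>"
  shows "restrict (\<lambda>i. if P (x i) then x i else 0) {..<n} \<in> dyadic_vecs n K k"
proof -
  have "(if P a then a else 0) \<in> dyadic k K" if "a \<in> dyadic 0 K" for a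
    using that
  proof (cases rule: dyadic_cases)
    case (2 p)
    then show ?thesis using P[of a] by (auto intro: dyadicI[where p = p])
  qed auto
  moreover have "(\<Sum>i<n. (restrict (\<lambda>i. if P (x i) then x i else 0) {..<n} i)\<^sup>2) \<le> (\<Sum>i<n. (x i)\<^sup>2)"
    by (intro sum_mono) auto
  ultimately show ?thesis
    using x by (auto simp: dyadic_vecs_def)
qed

lemma dyadic_vecs_entry_le:
  assumes "x \<in> dyadic_vecs n K k" "i < n"
  shows "\<bar>x i\<bar> \<le> sqrt (5 * real n)"
proof -
  have "(x i)\<^sup>2 \<le> (\<Sum>i<n. (x i)\<^sup>2)" using assms by (intro member_le_sum) auto
  also have "\<dots> \<le> 5 * real n" using assms by (simp add: dyadic_vecs_def)
  finally show ?thesis using real_le_rsqrt[of "\<bar>x i\<bar>"] by simp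
qed

text \<open>Products of coordinates could in general be of order n. The bound imposed here is what
  admits a Chernoff parameter of order 1 / (2^k sqrt (n gamma)) at level k.\<close>

definition balanced_pairs :: "nat \<Rightarrow> nat \<Rightarrow> nat \<Rightarrow> ((nat \<Rightarrow> real) \<times> (nat \<Rightarrow> real)) set" where
  "balanced_pairs n K k = {(x, y) \<in> dyadic_vecs n K k \<times> dyadic_vecs n K k.
     \<forall>i<n. \<forall>j<n. \<bar>x i * y j\<bar> \<le> 2 ^ k * sqrt (5 * real n)}"

lemma balanced_pairs_swap: "(x, y) \<in> balanced_pairs n K k \<Longrightarrow> (y, x) \<in> balanced_pairs n K k"
  by (auto simp: balanced_pairs_def mult.commute)

text \<open>Nonzero coordinates of the second vector have modulus exactly 2^k, and those of the
  first are at most sqrt (5 n) by the bound on the sum of squares.\<close>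

lemma balanced_pairsI:
  assumes x: "x \<in> dyadic_vecs n K 0" and y: "y \<in> dyadic_vecs n K 0"
    and P: "\<And>a. P a \<Longrightarrow> 2 ^ k \<le> \<bar>a\<bar>"
  shows "(restrict (\<lambda>i. if P (x i) then x i else 0) {..<n},
          restrict (\<lambda>i. if \<bar>y i\<bar> = 2 ^ k then y i else 0) {..<n}) \<in> balanced_pairs n K k"
    (is "(?x, ?y) \<in> _")
proof -
  have X: "?x \<in> dyadic_vecs n K k" by (rule dyadic_vecs_restrict[OF x P])
  have Y: "?y \<in> dyadic_vecs n K k" by (rule dyadic_vecs_restrict[OF y]) simp
  have "\<bar>?x i * ?y j\<bar> \<le> 2 ^ k * sqrt (5 * real n)" if "i < n" "j < n" for i j
  proof -
    have "\<bar>?x i * ?y j\<bar> = \<bar>?y j\<bar> * \<bar>?x i\<bar>" by (simp only: abs_mult mult.commute)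
    also have "\<dots> \<le> 2 ^ k * sqrt (5 * real n)"
      by (rule mult_mono[OF _ dyadic_vecs_entry_le[OF X]]) (use that in auto)
    finally show ?thesis .
  qed
  with X Y show ?thesis by (auto simp: balanced_pairs_def)
qed

text \<open>The deterministic half of the argument: all test vectors are reduced to finitely many
  pairs. The factor 8 is 2 * 4, from two pairs per level and the series bound 4; dividing by n
  undoes the scaling of both vectors by sqrt n.\<close>

lemma bilin_le_of_balanced_pairs:
  assumes n: "n > 0" and K: "real n \<le> 4 ^ K" and T: "T \<ge> 0"
    and E: "\<And>k x y. k \<le> K \<Longrightarrow> (x, y) \<in> balanced_pairs n K k \<Longrightarrow>
              bilin n E x y \<le> T * (real (k + 1) / 2 ^ k)"
    and u: "(\<Sum>i<n. (u i)\<^sup>2) \<le> 1" and v: "(\<Sum>i<n. (v i)\<^sup>2) \<le> 1"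
  shows "bilin n E u v \<le> 8 * T / real n"
proof -
  let ?s = "\<lambda>i. sqrt n * u i" and ?t = "\<lambda>i. sqrt n * v i"
  have "(\<Sum>i<n. (?s i)\<^sup>2) \<le> real n" "(\<Sum>i<n. (?t i)\<^sup>2) \<le> real n"
    using mult_left_mono[OF u, of "real n"] mult_left_mono[OF v, of "real n"]
    by (simp_all add: power_mult_distrib sum_distrib_left)
  then obtain x y where x: "x \<in> dyadic_vecs n K 0" and y: "y \<in> dyadic_vecs n K 0"
    and le: "bilin n E ?s ?t \<le> bilin n E x y"
    using K by (rule bilin_rounding)
  let ?r = "\<lambda>P z. restrict (\<lambda>i. if P (z i) then z i else (0::real)) {..<n}"
  define lo where "lo k = (\<lambda>a::real. 2 ^ k \<le> \<bar>a\<bar>)" for k :: nat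
  define eq where "eq k = (\<lambda>a::real. \<bar>a\<bar> = 2 ^ k)" for k :: nat
  define hi where "hi k = (\<lambda>a::real. 2 ^ k < \<bar>a\<bar>)" for k :: nat
  have prod: "x i * y j = (\<Sum>k\<le>K. ?r (lo k) x i * ?r (eq k) y j + ?r (eq k) x i * ?r (hi k) y j)"
    if "i < n" "j < n" for i j
    using dyadic_product_split[of "x i" K "y j"] x y that
    by (auto simp: dyadic_vecs_def PiE_iff lo_def eq_def hi_def)
  have "bilin n E x y = (\<Sum>i<n. \<Sum>j<n. \<Sum>k\<le>K.
      ?r (lo k) x i * ?r (eq k) y j * E i j + ?r (eq k) x i * ?r (hi k) y j * E i j)"
    unfolding bilin_def
    by (intro sum.cong refl) (simp only: prod lessThan_iff sum_distrib_right distrib_right)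
  also have "\<dots> = (\<Sum>k\<le>K. \<Sum>i<n. \<Sum>j<n.
      ?r (lo k) x i * ?r (eq k) y j * E i j + ?r (eq k) x i * ?r (hi k) y j * E i j)"
    by (subst (2) sum.swap, subst sum.swap) (rule refl)
  also have "\<dots> = (\<Sum>k\<le>K. bilin n E (?r (lo k) x) (?r (eq k) y) + bilin n E (?r (eq k) x) (?r (hi k) y))"
    by (simp only: bilin_def sum.distrib)
  also have "\<dots> \<le> (\<Sum>k\<le>K. T * (real (k + 1) / 2 ^ k) + T * (real (k + 1) / 2 ^ k))"
  proof (intro sum_mono add_mono E)
    fix k
    show "(?r (lo k) x, ?r (eq k) y) \<in> balanced_pairs n K k"
      unfolding eq_def by (rule balanced_pairsI[OF x y]) (simp add: lo_def)
    show "(?r (eq k) x, ?r (hi k) y) \<in> balanced_pairs n K k"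
      unfolding eq_def
      by (rule balanced_pairs_swap, rule balanced_pairsI[OF y x]) (simp add: hi_def)
  qed auto
  also have "\<dots> = 2 * T * (\<Sum>k\<le>K. real (k + 1) / 2 ^ k)"
    by (simp add: sum_distrib_left mult.assoc flip: sum.distrib)
  also have "\<dots> \<le> 2 * T * 4"
    using T by (intro mult_left_mono sum_Suc_half_power) auto
  finally have "bilin n E ?s ?t \<le> 8 * T" using le by simp
  moreover have "bilin n E ?s ?t = real n * bilin n E u v"
  proof -
    have "sqrt n * a * (sqrt n * b) * c = real n * (a * b * c)" for a b c :: real
    proof -
      have "sqrt n * a * (sqrt n * b) * c = (sqrt n * sqrt n) * (a * b * c)"
        by (simp only: ac_simps)
      then show ?thesis by simp
    qed
    then show ?thesis by (simp only: bilin_def sum_distrib_left)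
  qed
  ultimately show ?thesis using n by (simp add: field_simps)
qed

section \<open>Counting balanced pairs and choosing the top level\<close>

lemma finite_balanced_pairs: "finite (balanced_pairs n K k)"
  unfolding balanced_pairs_def
  by (rule finite_subset[of _ "dyadic_vecs n K k \<times> dyadic_vecs n K k"])
    (auto simp: finite_dyadic_vecs)

lemma card_balanced_pairs_le:
  "real (card (balanced_pairs n K k)) \<le> exp (22 * real n * real (k + 1) / 4 ^ k)"
proof -
  have "card (balanced_pairs n K k) \<le> card (dyadic_vecs n K k \<times> dyadic_vecs n K k)"
    unfolding balanced_pairs_def by (intro card_mono) (auto simp: finite_dyadic_vecs)
  then have "real (card (balanced_pairs n K k))
      \<le> real (card (dyadic_vecs n K k)) * real (card (dyadic_vecs n K k))"
    by (simp add: card_cartesian_product flip: of_nat_mult)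
  also have "\<dots> \<le> exp (11 * real n * real (k + 1) / 4 ^ k) * exp (11 * real n * real (k + 1) / 4 ^ k)"
    by (intro mult_mono card_dyadic_vecs_le) auto
  also have "\<dots> = exp (22 * real n * real (k + 1) / 4 ^ k)"
    by (simp add: field_simps flip: exp_add)
  finally show ?thesis .
qed

text \<open>The lower bound on 4^K keeps coordinates of modulus up to sqrt n below 2^K. The upper
  bound gives n / 4^k >= 1/4 at every level k <= K, which makes the failure probabilities
  summable.\<close>

lemma ex_four_power_between:
  assumes "n > 0"
  obtains K where "real n \<le> 4 ^ K" "4 ^ K \<le> 4 * real n"
proof -
  define K where "K = (LEAST K. real n \<le> 4 ^ K)"
  have "real n \<le> 4 ^ n"
    using Bernoulli_inequality[of "3::real" n] by simp
  then have K: "real n \<le> 4 ^ K" unfolding K_def by (rule LeastI)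
  moreover have "4 ^ K \<le> 4 * real n"
  proof (cases K)
    case 0
    then show ?thesis using assms by simp
  next
    case (Suc i)
    then have "\<not> real n \<le> 4 ^ i"
      using not_less_Least[of i "\<lambda>K. real n \<le> 4 ^ K"] unfolding K_def by simp
    then show ?thesis using Suc by simp
  qed
  ultimately show ?thesis by (rule that)
qed

subsection \<open>The norm of a matrix of Bernoulli sums\<close>

definition coins :: "nat \<Rightarrow> nat \<Rightarrow> (nat \<Rightarrow> nat \<Rightarrow> real) \<Rightarrow> (nat \<times> nat \<times> nat \<Rightarrow> bool) pmf" where
  "coins m n p =
     Pi_pmf {(k, i, j). k < m \<and> i < n \<and> j < n} False (\<lambda>(k, i, j). bernoulli_pmf (p i j))"

text \<open>The DIMSUM error up to a scalar, with weights \<open>e\<close> left abstract so that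
  they can be normalised.\<close>

definition noise :: "nat \<Rightarrow> (nat \<Rightarrow> nat \<Rightarrow> real) \<Rightarrow> (nat \<Rightarrow> nat \<Rightarrow> nat \<Rightarrow> real) \<Rightarrow>
    (nat \<times> nat \<times> nat \<Rightarrow> bool) \<Rightarrow> nat \<Rightarrow> nat \<Rightarrow> real" where
  "noise m p e \<omega> i j = (\<Sum>k<m. e k i j * (of_bool (\<omega> (k, i, j)) - p i j))"

lemma sum_coin_index:
  fixes f :: "nat \<times> nat \<times> nat \<Rightarrow> real"
  shows "(\<Sum>q\<in>{(k, i, j). k < m \<and> i < n \<and> j < n}. f q) = (\<Sum>i<n. \<Sum>j<n. \<Sum>k<m. f (k, i, j))"
proof -
  have "{(k, i, j). k < m \<and> i < n \<and> j < n} = {..<m} \<times> {..<n} \<times> {..<n}" by auto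
  then have "(\<Sum>q\<in>{(k, i, j). k < m \<and> i < n \<and> j < n}. f q) = (\<Sum>k<m. \<Sum>i<n. \<Sum>j<n. f (k, i, j))"
    by (simp add: sum.cartesian_product)
  also have "\<dots> = (\<Sum>i<n. \<Sum>k<m. \<Sum>j<n. f (k, i, j))" by (rule sum.swap)
  also have "\<dots> = (\<Sum>i<n. \<Sum>j<n. \<Sum>k<m. f (k, i, j))"
    by (intro sum.cong refl sum.swap)
  finally show ?thesis .
qed

context
  fixes m n :: nat and p :: "nat \<Rightarrow> nat \<Rightarrow> real" and e :: "nat \<Rightarrow> nat \<Rightarrow> nat \<Rightarrow> real"
    and \<gamma> :: real
  assumes n: "n > 0" and \<gamma>: "\<gamma> \<ge> 1"
    and p: "\<And>i j. i < n \<Longrightarrow> j < n \<Longrightarrow> 0 \<le> p i j \<and> p i j \<le> 1"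
    and e: "\<And>k i j. k < m \<Longrightarrow> i < n \<Longrightarrow> j < n \<Longrightarrow> p i j < 1 \<Longrightarrow> \<bar>e k i j\<bar> \<le> 1"
    and var: "\<And>i j. i < n \<Longrightarrow> j < n \<Longrightarrow> (\<Sum>k<m. (e k i j)\<^sup>2 * p i j * (1 - p i j)) \<le> \<gamma>"
begin

text \<open>Chernoff with parameter 1 / r, where r = 2^k sqrt (5 n gamma). The weights are at most 1
  where p < 1, because the pair is balanced and gamma >= 1. The variance is at most (5 n)^2 gamma /
  r^2 = 5 n / 4^k and the scaled threshold is 35 n (k + 1) / 4^k, so at least 35 - 5 = 30
  remains.\<close>

lemma balanced_pair_tail:
  assumes xy: "(x, y) \<in> balanced_pairs n K k"
  shows "measure_pmf.prob (coins m n p)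
           {\<omega>. 35 * real n * sqrt (5 * real n * \<gamma>) * (real (k + 1) / 2 ^ k) \<le> bilin n (noise m p e \<omega>) x y}
         \<le> exp (- (30 * real n * real (k + 1) / 4 ^ k))"
proof -
  let ?I = "{(k, i, j). k < m \<and> i < n \<and> j < n}"
  define r where "r = 2 ^ k * sqrt (5 * real n * \<gamma>)"
  define P where "P q = (case q of (k, i, j) \<Rightarrow> p i j)" for q :: "nat \<times> nat \<times> nat"
  define w where "w q = (case q of (k, i, j) \<Rightarrow> x i * y j * e k i j / r)" for q :: "nat \<times> nat \<times> nat"
  have r: "r > 0" using n \<gamma> by (simp add: r_def)
  have r2: "r\<^sup>2 = 4 ^ k * (5 * real n * \<gamma>)"
  proof -
    have "((2::real) ^ k)\<^sup>2 = 4 ^ k" by (simp add: power2_eq_square flip: power_mult_distrib)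
    then show ?thesis using n \<gamma> by (simp add: r_def power_mult_distrib)
  qed
  have fin: "finite ?I"
    by (rule finite_subset[of _ "{..<m} \<times> {..<n} \<times> {..<n}"]) auto
  have x: "(\<Sum>i<n. (x i)\<^sup>2) \<le> 5 * real n" and y: "(\<Sum>i<n. (y i)\<^sup>2) \<le> 5 * real n"
    using xy by (auto simp: balanced_pairs_def dyadic_vecs_def)
  have w: "\<bar>w q\<bar> \<le> 1" if "q \<in> ?I" "P q < 1" for q
  proof -
    obtain l i j where q: "q = (l, i, j)" by (cases q)
    then have l: "l < m" "i < n" "j < n" "p i j < 1" using that by (auto simp: P_def)
    have "\<bar>x i * y j\<bar> \<le> 2 ^ k * sqrt (5 * real n)" using xy l by (auto simp: balanced_pairs_def)
    also have "\<dots> \<le> r" using \<gamma> n by (simp add: r_def)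
    finally have "\<bar>x i * y j\<bar> * \<bar>e l i j\<bar> \<le> r * 1"
      using e[OF l] r by (intro mult_mono) auto
    then show ?thesis using r by (simp add: w_def q abs_mult)
  qed
  have sum_eq: "(\<Sum>q\<in>?I. w q * (of_bool (\<omega> q) - P q)) = bilin n (noise m p e \<omega>) x y / r" for \<omega>
    unfolding sum_coin_index
    by (simp add: bilin_def noise_def w_def P_def sum_divide_distrib sum_distrib_left mult.assoc)
  have "(\<Sum>q\<in>?I. (w q)\<^sup>2 * P q * (1 - P q))
      = (\<Sum>i<n. \<Sum>j<n. ((x i)\<^sup>2 * (y j)\<^sup>2) / r\<^sup>2 * (\<Sum>k<m. (e k i j)\<^sup>2 * p i j * (1 - p i j)))"
    unfolding sum_coin_index
    by (simp add: w_def P_def sum_distrib_left power_mult_distrib power_divide mult.assoc)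
  also have "\<dots> \<le> (\<Sum>i<n. \<Sum>j<n. ((x i)\<^sup>2 * (y j)\<^sup>2) / r\<^sup>2 * \<gamma>)"
    by (intro sum_mono mult_left_mono var) auto
  also have "\<dots> = (\<Sum>i<n. (x i)\<^sup>2) * (\<Sum>j<n. (y j)\<^sup>2) * (\<gamma> / r\<^sup>2)"
    by (simp only: sum_product) (simp add: sum_distrib_right sum_divide_distrib)
  also have "\<dots> \<le> (5 * real n) * (5 * real n) * (\<gamma> / r\<^sup>2)"
    using x y \<gamma> by (intro mult_right_mono mult_mono) (auto intro: sum_nonneg)
  also have "\<dots> = 5 * real n / 4 ^ k"
    using n \<gamma> by (simp add: r2 field_simps)
  also have "\<dots> \<le> 5 * real n * real (k + 1) / 4 ^ k" 
    using n by (simp add: divide_right_mono)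
  finally have V: "(\<Sum>q\<in>?I. (w q)\<^sup>2 * P q * (1 - P q)) \<le> 5 * real n * real (k + 1) / 4 ^ k" .
  have thr: "35 * real n * sqrt (5 * real n * \<gamma>) * (real (k + 1) / 2 ^ k) / r
      = 35 * real n * real (k + 1) / 4 ^ k" (is "?t / r = _")
  proof -
    have "(4::real) ^ k = 2 ^ k * 2 ^ k" by (simp flip: power_mult_distrib)
    then show ?thesis using n \<gamma> by (simp add: r_def field_simps)
  qed
  have ev: "{\<omega>. ?t \<le> bilin n (noise m p e \<omega>) x y} = {\<omega>. ?t / r \<le> (\<Sum>q\<in>?I. w q * (of_bool (\<omega> q) - P q))}"
    unfolding sum_eq using r by (simp only: divide_le_cancel) simp
  have "coins m n p = Pi_pmf ?I False (\<lambda>q. bernoulli_pmf (P q))"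
    unfolding coins_def P_def by (rule arg_cong[of _ _ "Pi_pmf _ _"]) auto
  then have "measure_pmf.prob (coins m n p) {\<omega>. ?t \<le> bilin n (noise m p e \<omega>) x y}
      = measure_pmf.prob (Pi_pmf ?I False (\<lambda>q. bernoulli_pmf (P q)))
          {\<omega>. ?t / r \<le> (\<Sum>q\<in>?I. w q * (of_bool (\<omega> q) - P q))}"
    by (simp only: ev)
  also have "\<dots> \<le> exp ((\<Sum>q\<in>?I. (w q)\<^sup>2 * P q * (1 - P q)) - ?t / r)"
    using fin p w by (intro bernoulli_sum_tail) (auto simp: P_def)
  also have "\<dots> \<le> exp (- (30 * real n * real (k + 1) / 4 ^ k))"
  proof -
    define z where "z = real n * real (k + 1) / 4 ^ k"
    have z: "a * real n * real (k + 1) / 4 ^ k = a * z" for a by (simp add: z_def)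
    show ?thesis using V unfolding thr exp_le_cancel_iff z by linarith
  qed
  finally show ?thesis .
qed

text \<open>Union bound over all levels and all balanced pairs, followed by the deterministic
  reduction; 280 = 8 * 35.\<close>

lemma noise_bilin_bound:
  "measure_pmf.prob (coins m n p) {\<omega>. \<forall>u v. (\<Sum>i<n. (u i)\<^sup>2) \<le> 1 \<longrightarrow> (\<Sum>i<n. (v i)\<^sup>2) \<le> 1 \<longrightarrow>
      bilin n (noise m p e \<omega>) u v \<le> 280 * sqrt (5 * real n * \<gamma>)} \<ge> 1 / 2"
proof -
  obtain K where K: "real n \<le> 4 ^ K" "4 ^ K \<le> 4 * real n"
    using ex_four_power_between[OF n] by blast
  define T where "T = 35 * real n * sqrt (5 * real n * \<gamma>)"
  define bad where "bad = (\<lambda>(k, x, y). {\<omega>. T * (real (k + 1) / 2 ^ k) \<le> bilin n (noise m p e \<omega>) x y})"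
  let ?J = "Sigma {..K} (balanced_pairs n K)"
  have "measure_pmf.prob (coins m n p) (\<Union>q\<in>?J. bad q) \<le> (\<Sum>q\<in>?J. measure_pmf.prob (coins m n p) (bad q))"
    by (intro measure_pmf.finite_measure_subadditive_finite) (auto simp: finite_balanced_pairs)
  also have "\<dots> = (\<Sum>k\<le>K. \<Sum>xy\<in>balanced_pairs n K k. measure_pmf.prob (coins m n p) (bad (k, xy)))"
    by (simp add: sum.Sigma finite_balanced_pairs)
  also have "\<dots> \<le> (\<Sum>k\<le>K. (1/4) ^ Suc k)"
  proof (rule sum_mono)
    fix k assume "k \<in> {..K}"
    then have "(4::real) ^ k \<le> 4 ^ K" by (simp add: power_increasing)
    then have "(4::real) ^ k \<le> 4 * real n" using K(2) by (rule order.trans)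
    then have nk: "1 / 4 \<le> real n / 4 ^ k" by (simp add: field_simps)
    have "(\<Sum>xy\<in>balanced_pairs n K k. measure_pmf.prob (coins m n p) (bad (k, xy)))
        \<le> (\<Sum>xy\<in>balanced_pairs n K k. exp (- (30 * real n * real (k + 1) / 4 ^ k)))"
      using balanced_pair_tail[of _ _ K k] by (intro sum_mono) (auto simp: bad_def T_def)
    also have "\<dots> = real (card (balanced_pairs n K k)) * exp (- (30 * real n * real (k + 1) / 4 ^ k))"
      by simp
    also have "\<dots> \<le> exp (22 * real n * real (k + 1) / 4 ^ k) * exp (- (30 * real n * real (k + 1) / 4 ^ k))"
      by (intro mult_right_mono card_balanced_pairs_le) auto
    \<comment> \<open>The tail exponent 30 beats the entropy 22 of the pairs by 8. With n / 4^k >=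
      1/4 this leaves at most -2 (k + 1) in the exponent.\<close>
    also have "\<dots> = exp (- (8 * real (k + 1) * (real n / 4 ^ k)))"
      by (simp add: field_simps flip: exp_add)
    also have "\<dots> \<le> exp (- (2 * real (Suc k)))"
      using mult_left_mono[OF nk, of "8 * real (k + 1)"] by simp
    also have "\<dots> \<le> (1/4) ^ Suc k" by (rule exp_minus_le_quarter_power)
    finally show "(\<Sum>xy\<in>balanced_pairs n K k. measure_pmf.prob (coins m n p) (bad (k, xy))) \<le> (1/4) ^ Suc k" .
  qed
  also have "\<dots> \<le> 1 / 2" using sum_quarter_power[of 0 K] by (simp add: atLeast0AtMost)
  finally have small: "measure_pmf.prob (coins m n p) (\<Union>q\<in>?J. bad q) \<le> 1 / 2" .
  have "- (\<Union>q\<in>?J. bad q) \<subseteq> {\<omega>. \<forall>u v. (\<Sum>i<n. (u i)\<^sup>2) \<le> 1 \<longrightarrow> (\<Sum>i<n. (v i)\<^sup>2) \<le> 1 \<longrightarrow>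
      bilin n (noise m p e \<omega>) u v \<le> 280 * sqrt (5 * real n * \<gamma>)}" (is "_ \<subseteq> ?G")
  proof (intro subsetI CollectI allI impI)
    fix \<omega> and u v :: "nat \<Rightarrow> real" assume "\<omega> \<in> - (\<Union>q\<in>?J. bad q)"
    then have "bilin n (noise m p e \<omega>) x y \<le> T * (real (k + 1) / 2 ^ k)"
      if "k \<le> K" "(x, y) \<in> balanced_pairs n K k" for k x y
      using that by (force simp: bad_def)
    moreover assume "(\<Sum>i<n. (u i)\<^sup>2) \<le> 1" "(\<Sum>i<n. (v i)\<^sup>2) \<le> 1"
    ultimately have "bilin n (noise m p e \<omega>) u v \<le> 8 * T / real n"
      using \<gamma> by (intro bilin_le_of_balanced_pairs[OF n K(1)]) (auto simp: T_def)
    then show "bilin n (noise m p e \<omega>) u v \<le> 280 * sqrt (5 * real n * \<gamma>)"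
      using n by (simp add: T_def)
  qed
  then have "measure_pmf.prob (coins m n p) (- (\<Union>q\<in>?J. bad q)) \<le> measure_pmf.prob (coins m n p) ?G"
    by (intro measure_pmf.finite_measure_mono) auto
  moreover have "measure_pmf.prob (coins m n p) (- (\<Union>q\<in>?J. bad q))
      = 1 - measure_pmf.prob (coins m n p) (\<Union>q\<in>?J. bad q)"
    using measure_pmf.prob_compl[of "\<Union>q\<in>?J. bad q" "coins m n p"] by (simp add: Compl_eq_Diff_UNIV)
  ultimately show ?thesis using small by linarith
qed

end

subsection \<open>The spectral norm of the DIMSUM error\<close>

text \<open>A one-sided bound on the bilinear form suffices, since u may be taken as Mx / |Mx|. If
  Mx = 0, zero test vectors still yield b >= 0.\<close>

lemma spec_norm_le:
  assumes bound: "\<And>u v. (\<Sum>i<n. (u i)\<^sup>2) \<le> 1 \<Longrightarrow> (\<Sum>i<n. (v i)\<^sup>2) \<le> 1 \<Longrightarrow> bilin n M u v \<le> b"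
  shows "spec_norm n M \<le> b"
  unfolding spec_norm_def
proof (rule cSup_least)
  show "{sqrt (\<Sum>i<n. (\<Sum>j<n. M i j * x j)\<^sup>2) |x. (\<Sum>j<n. (x j)\<^sup>2) \<le> 1} \<noteq> {}"
    by (auto intro: exI[of _ "\<lambda>_. 0"])
next
  fix s assume "s \<in> {sqrt (\<Sum>i<n. (\<Sum>j<n. M i j * x j)\<^sup>2) |x. (\<Sum>j<n. (x j)\<^sup>2) \<le> 1}"
  then obtain x where x: "(\<Sum>j<n. (x j)\<^sup>2) \<le> 1" and s: "s = sqrt (\<Sum>i<n. (\<Sum>j<n. M i j * x j)\<^sup>2)"
    by blast
  define y where "y i = (\<Sum>j<n. M i j * x j)" for i
  have s2: "s\<^sup>2 = (\<Sum>i<n. (y i)\<^sup>2)" by (simp add: s y_def sum_nonneg)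
  have s0: "s \<ge> 0" by (simp add: s sum_nonneg)
  show "s \<le> b"
  proof (cases "s = 0")
    case True
    then show ?thesis using bound[of "\<lambda>_. 0" "\<lambda>_. 0"] by (simp add: bilin_def)
  next
    case False
    have "(\<Sum>i<n. (y i / s)\<^sup>2) = s\<^sup>2 / s\<^sup>2"
      unfolding power_divide sum_divide_distrib[symmetric] s2 ..
    then have "bilin n M (\<lambda>i. y i / s) x \<le> b" using False x by (intro bound) auto
    moreover have "bilin n M (\<lambda>i. y i / s) x = (\<Sum>i<n. (y i)\<^sup>2) / s"
      by (simp add: bilin_def power2_eq_square sum_divide_distrib)
        (simp add: y_def sum_distrib_left mult_ac sum_divide_distrib)
    ultimately have "s\<^sup>2 / s \<le> b" by (simp only: s2)
    then show ?thesis using False by (simp add: power2_eq_square)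
  qed
qed

text \<open>A supremum of reals is an upper bound only of a bounded set; the crude bound by the sum
  of all moduli is enough for that.\<close>

lemma bdd_above_spec_norm:
  fixes n :: nat and M :: "nat \<Rightarrow> nat \<Rightarrow> real"
  shows "bdd_above {sqrt (\<Sum>i<n. (\<Sum>j<n. M i j * x j)\<^sup>2) |x. (\<Sum>j<n. (x j)\<^sup>2) \<le> 1}"
proof (rule bdd_aboveI, clarify)
  fix x :: "nat \<Rightarrow> real" assume x: "(\<Sum>j<n. (x j)\<^sup>2) \<le> 1"
  have x1: "\<bar>x j\<bar> \<le> 1" if "j < n" for j
  proof -
    have "(x j)\<^sup>2 \<le> (\<Sum>j<n. (x j)\<^sup>2)" using that by (intro member_le_sum) auto
    then show ?thesis using x abs_square_le_1[of "x j"] by linarith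
  qed
  have "sqrt (\<Sum>i<n. (\<Sum>j<n. M i j * x j)\<^sup>2) \<le> (\<Sum>i<n. \<bar>\<Sum>j<n. M i j * x j\<bar>)"
    using L2_set_le_sum_abs[of "\<lambda>i. \<Sum>j<n. M i j * x j" "{..<n}"] by (simp add: L2_set_def)
  also have "\<dots> \<le> (\<Sum>i<n. \<Sum>j<n. \<bar>M i j\<bar>)"
  proof (rule sum_mono)
    fix i
    have "\<bar>\<Sum>j<n. M i j * x j\<bar> \<le> (\<Sum>j<n. \<bar>M i j * x j\<bar>)" by (rule sum_abs)
    also have "\<dots> \<le> (\<Sum>j<n. \<bar>M i j\<bar>)"
      by (intro sum_mono) (auto simp: abs_mult intro!: mult_left_le x1)
    finally show "\<bar>\<Sum>j<n. M i j * x j\<bar> \<le> (\<Sum>j<n. \<bar>M i j\<bar>)" .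
  qed
  finally show "sqrt (\<Sum>i<n. (\<Sum>j<n. M i j * x j)\<^sup>2) \<le> (\<Sum>i<n. \<Sum>j<n. \<bar>M i j\<bar>)" .
qed

text \<open>Tested on the i-th unit vector. For the Gram matrix this bounds each squared column norm
  by its spectral norm, the only lower bound on that norm the proof uses.\<close>

lemma diagonal_le_spec_norm:
  assumes i: "i < n"
  shows "M i i \<le> spec_norm n M"
proof -
  define x :: "nat \<Rightarrow> real" where "x j = of_bool (j = i)" for j
  have "(\<Sum>j<n. (x j)\<^sup>2) = (\<Sum>j<n. if j = i then 1 else 0)"
    by (rule sum.cong) (auto simp: x_def)
  then have x: "(\<Sum>j<n. (x j)\<^sup>2) \<le> 1" using i by simp
  have Mx: "(\<Sum>j<n. M l j * x j) = M l i" for l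
  proof -
    have "(\<Sum>j<n. M l j * x j) = (\<Sum>j<n. if j = i then M l i else 0)"
      by (rule sum.cong) (auto simp: x_def)
    then show ?thesis using i by simp
  qed
  have "(M i i)\<^sup>2 \<le> (\<Sum>l<n. (M l i)\<^sup>2)" using i by (intro member_le_sum) auto
  then have "M i i \<le> sqrt (\<Sum>l<n. (M l i)\<^sup>2)" by (rule real_le_rsqrt)
  also have "\<dots> = sqrt (\<Sum>l<n. (\<Sum>j<n. M l j * x j)\<^sup>2)" by (simp add: Mx)
  also have "\<dots> \<le> spec_norm n M"
    unfolding spec_norm_def using x by (intro cSup_upper bdd_above_spec_norm) blast
  finally show ?thesis .
qed

text \<open>Both branches of \<open>dimsum_B\<close>, multiplied by the two column norms, become the
  emitted sum divided by p_ij: in the first branch p_ij is the quotient, in the second it is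
  1.\<close>

lemma DBD_minus_gram:
  assumes "\<gamma> > 0" "col_norm m A i > 0" "col_norm m A j > 0"
  shows "DBD m A \<gamma> \<omega> i j - gram m A i j =
    (\<Sum>k<m. A k i * A k j / dimsum_p m A \<gamma> i j * (of_bool (\<omega> (k, i, j)) - dimsum_p m A \<gamma> i j))"
proof -
  let ?p = "dimsum_p m A \<gamma> i j"
  have p: "?p > 0" using assms by (simp add: dimsum_p_def)
  have "DBD m A \<gamma> \<omega> i j = (\<Sum>k<m. dimsum_X A \<omega> i j k) / ?p"
    using assms by (simp add: DBD_def dimsum_B_def dimsum_p_def min_def)
  also have "\<dots> = (\<Sum>k<m. A k i * A k j / ?p * of_bool (\<omega> (k, i, j)))"
    unfolding sum_divide_distrib by (rule sum.cong) (auto simp: dimsum_X_def)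
  finally have "DBD m A \<gamma> \<omega> i j - gram m A i j
      = (\<Sum>k<m. A k i * A k j / ?p * of_bool (\<omega> (k, i, j)) - A k i * A k j)"
    by (simp only: gram_def sum_subtractf)
  also have "\<dots> = (\<Sum>k<m. A k i * A k j / ?p * (of_bool (\<omega> (k, i, j)) - ?p))"
  proof (rule sum.cong[OF refl])
    fix k
    have "a / ?p * b - a = a / ?p * (b - ?p)" for a b using p by (simp add: field_simps)
    then show "A k i * A k j / ?p * of_bool (\<omega> (k, i, j)) - A k i * A k j
        = A k i * A k j / ?p * (of_bool (\<omega> (k, i, j)) - ?p)" .
  qed
  finally show ?thesis .
qed

lemma dimsum_spec_norm_bound:
  assumes n: "n > 0" and A: "\<And>k i. k < m \<Longrightarrow> i < n \<Longrightarrow> \<bar>A k i\<bar> \<le> 1"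
    and nz: "\<And>i. i < n \<Longrightarrow> \<exists>k<m. A k i \<noteq> 0" and \<gamma>: "\<gamma> \<ge> 1"
  shows "spec_norm n (gram m A) > 0"
    and "measure_pmf.prob (dimsum_coins m n A \<gamma>)
           {\<omega>. spec_norm n (\<lambda>i j. DBD m A \<gamma> \<omega> i j - gram m A i j)
                \<le> spec_norm n (gram m A) / \<gamma> * (280 * sqrt (5 * real n * \<gamma>))} \<ge> 1 / 2"
proof -
  define M where "M = spec_norm n (gram m A)"
  define p where "p = dimsum_p m A \<gamma>"
  define c where "c = col_norm m A"
  have c: "c i > 0" if i: "i < n" for i
  proof -
    obtain k where "k < m" "A k i \<noteq> 0" using nz[OF i] by blast
    then have "(\<Sum>k<m. (A k i)\<^sup>2) > 0" by (intro sum_pos2[of _ k]) auto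
    then show ?thesis by (simp add: c_def col_norm_def)
  qed
  have c2: "(c i)\<^sup>2 \<le> M" if "i < n" for i
    using diagonal_le_spec_norm[OF that, of "gram m A"]
    by (simp add: c_def col_norm_def M_def gram_def sum_nonneg power2_eq_square)
  have "0 < (c 0)\<^sup>2" using c[OF n] by simp
  then have M: "M > 0" using c2[OF n] by linarith
  then show "spec_norm n (gram m A) > 0" by (simp add: M_def)
  have cc: "c i * c j \<le> M" if "i < n" "j < n" for i j
  proof -
    have "c i \<le> sqrt M" "c j \<le> sqrt M" using c2 that by (auto intro: real_le_rsqrt)
    then have "c i * c j \<le> sqrt M * sqrt M" using c that M by (intro mult_mono) (auto simp: less_imp_le)
    then show ?thesis using M by simp
  qed
  have p01: "0 < p i j \<and> p i j \<le> 1" if "i < n" "j < n" for i j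
    using c that \<gamma> by (simp add: p_def dimsum_p_def flip: c_def)
  have p_lt: "p i j = \<gamma> / (c i * c j)" if "p i j < 1" for i j
    using that by (auto simp: p_def dimsum_p_def c_def min_def split: if_splits)
  \<comment> \<open>Normalised so that the error is \<open>M / \<gamma>\<close> times
    \<open>noise\<close>. Where p < 1, gamma cancels and the factor c_i c_j / M <= 1
    remains.\<close>
  define e where "e k i j = A k i * A k j / p i j * (\<gamma> / M)" for k i j
  have e_lt: "e k i j = A k i * A k j * (c i * c j / M)" if "i < n" "j < n" "p i j < 1" for k i j
    using p_lt[OF that(3)] c[OF that(1)] c[OF that(2)] \<gamma> by (simp add: e_def)
  have q: "0 \<le> c i * c j / M" "c i * c j / M \<le> 1" if "i < n" "j < n" for i j
    using cc[OF that] c[OF that(1)] c[OF that(2)] M by simp_all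
  have AA: "\<bar>A k i * A k j\<bar> \<le> 1" if "k < m" "i < n" "j < n" for k i j
    using A that by (simp add: abs_mult mult_le_one)
  have e1: "\<bar>e k i j\<bar> \<le> 1" if "k < m" "i < n" "j < n" "p i j < 1" for k i j
    unfolding e_lt[OF that(2-4)] abs_mult[of "A k i * A k j"]
    using AA[OF that(1-3)] q[OF that(2,3)] by (intro mult_le_one) auto
  have var: "(\<Sum>k<m. (e k i j)\<^sup>2 * p i j * (1 - p i j)) \<le> \<gamma>" if ij: "i < n" "j < n" for i j
  proof (cases "p i j < 1")
    case False
    then have "p i j = 1" using p01[OF ij] by simp
    then show ?thesis using \<gamma> by simp
  next
    case True
    have cp: "c i * c j > 0" using c ij by simp
    \<comment> \<open>One factor |e| <= 1 is given away, so that only |a_ki a_kj| is left. Its sum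
      over k is at most c_i c_j by Cauchy-Schwarz, which cancels the denominator of p_ij.\<close>
    have "(\<Sum>k<m. (e k i j)\<^sup>2 * p i j * (1 - p i j)) \<le> (\<Sum>k<m. \<bar>A k i * A k j\<bar> * (\<gamma> / (c i * c j)))"
    proof (rule sum_mono)
      fix k assume k: "k \<in> {..<m}"
      have "\<bar>e k i j\<bar> * \<bar>e k i j\<bar> \<le> \<bar>e k i j\<bar> * 1"
        using e1[of k i j] k ij True by (intro mult_left_mono) auto
      also have "\<dots> = \<bar>A k i * A k j\<bar> * (c i * c j / M)"
        unfolding e_lt[OF ij True] abs_mult[of "A k i * A k j"] using q(1)[OF ij]
        by (simp only: abs_of_nonneg mult_1_right)
      also have "\<dots> \<le> \<bar>A k i * A k j\<bar>"
        using q[OF ij] by (intro mult_left_le) auto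
      finally have "(e k i j)\<^sup>2 \<le> \<bar>A k i * A k j\<bar>" by (simp add: power2_eq_square flip: abs_mult)
      then have "(e k i j)\<^sup>2 * p i j * (1 - p i j) \<le> \<bar>A k i * A k j\<bar> * p i j * 1"
        using p01[OF ij] by (intro mult_mono) auto
      then show "(e k i j)\<^sup>2 * p i j * (1 - p i j) \<le> \<bar>A k i * A k j\<bar> * (\<gamma> / (c i * c j))"
        by (simp add: p_lt[OF True])
    qed
    also have "\<dots> = (\<Sum>k<m. \<bar>A k i\<bar> * \<bar>A k j\<bar>) * (\<gamma> / (c i * c j))"
      by (simp only: abs_mult sum_distrib_right)
    also have "\<dots> \<le> (c i * c j) * (\<gamma> / (c i * c j))"
      using L2_set_mult_ineq[of "\<lambda>k. A k i" "\<lambda>k. A k j" "{..<m}"] cp \<gamma>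
      by (intro mult_right_mono) (auto simp: c_def col_norm_def L2_set_def)
    also have "\<dots> = \<gamma>" using less_imp_neq[OF cp] by simp
    finally show ?thesis .
  qed
  have noise: "DBD m A \<gamma> \<omega> i j - gram m A i j = M / \<gamma> * noise m p e \<omega> i j"
    if "i < n" "j < n" for \<omega> i j
    using DBD_minus_gram[of \<gamma> m A i j \<omega>] c[OF that(1)] c[OF that(2)] \<gamma> M
    by (simp add: noise_def e_def p_def c_def sum_distrib_left mult.assoc)
  let ?G = "{\<omega>. \<forall>u v. (\<Sum>i<n. (u i)\<^sup>2) \<le> 1 \<longrightarrow> (\<Sum>i<n. (v i)\<^sup>2) \<le> 1 \<longrightarrow>
      bilin n (noise m p e \<omega>) u v \<le> 280 * sqrt (5 * real n * \<gamma>)}"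
  have "1 / 2 \<le> measure_pmf.prob (coins m n p) ?G"
    by (rule noise_bilin_bound[OF n \<gamma> _ e1 var]) (use p01 in \<open>auto simp: less_imp_le\<close>)
  also have "coins m n p = dimsum_coins m n A \<gamma>"
    by (simp add: coins_def dimsum_coins_def p_def)
  also have "measure_pmf.prob \<dots> ?G \<le> measure_pmf.prob \<dots>
      {\<omega>. spec_norm n (\<lambda>i j. DBD m A \<gamma> \<omega> i j - gram m A i j) \<le> M / \<gamma> * (280 * sqrt (5 * real n * \<gamma>))}"
  proof (intro measure_pmf.finite_measure_mono subsetI CollectI spec_norm_le)
    fix \<omega> and u v :: "nat \<Rightarrow> real"
    assume "\<omega> \<in> ?G" "(\<Sum>i<n. (u i)\<^sup>2) \<le> 1" "(\<Sum>i<n. (v i)\<^sup>2) \<le> 1"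
    then have "bilin n (noise m p e \<omega>) u v \<le> 280 * sqrt (5 * real n * \<gamma>)" by blast
    then have "M / \<gamma> * bilin n (noise m p e \<omega>) u v \<le> M / \<gamma> * (280 * sqrt (5 * real n * \<gamma>))"
      using M \<gamma> by (intro mult_left_mono) auto
    moreover have "bilin n (\<lambda>i j. DBD m A \<gamma> \<omega> i j - gram m A i j) u v
        = M / \<gamma> * bilin n (noise m p e \<omega>) u v"
      unfolding bilin_def sum_distrib_left by (intro sum.cong refl) (simp add: noise)
    ultimately show "bilin n (\<lambda>i j. DBD m A \<gamma> \<omega> i j - gram m A i j) u v
        \<le> M / \<gamma> * (280 * sqrt (5 * real n * \<gamma>))" by simp
  qed auto
  finally show "measure_pmf.prob (dimsum_coins m n A \<gamma>)
           {\<omega>. spec_norm n (\<lambda>i j. DBD m A \<gamma> \<omega> i j - gram m A i j)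
                \<le> spec_norm n (gram m A) / \<gamma> * (280 * sqrt (5 * real n * \<gamma>))} \<ge> 1 / 2"
    by (simp add: M_def)
qed

theorem theorem2:
  shows "\<exists>C>0. \<forall>(m::nat) (n::nat) (A::nat \<Rightarrow> nat \<Rightarrow> real) (\<epsilon>::real) (\<gamma>::real).
           n < m \<longrightarrow>
           (\<forall>k<m. \<forall>i<n. \<bar>A k i\<bar> \<le> 1) \<longrightarrow>
           (\<forall>i<n. \<exists>k<m. A k i \<noteq> 0) \<longrightarrow>
           \<epsilon> > 0 \<longrightarrow> \<gamma> \<ge> C * real n / \<epsilon>\<^sup>2 \<longrightarrow> \<gamma> \<ge> 1 \<longrightarrow>
           measure_pmf.prob (dimsum_coins m n A \<gamma>)
             {\<omega>. spec_norm n (\<lambda>i j. DBD m A \<gamma> \<omega> i j - gram m A i j) / spec_norm n (gram m A)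
                   \<le> \<epsilon>} \<ge> 1 / 2"
\<comment> \<open>392000 = 5 * 280^2: then 280 sqrt (5 n gamma) <= epsilon gamma follows by
  comparing squares.\<close>
proof (rule exI[of _ "392000 :: real"], intro conjI allI impI)
  show "(392000::real) > 0" by simp
next
  fix m n :: nat and A :: "nat \<Rightarrow> nat \<Rightarrow> real" and \<epsilon> \<gamma> :: real
  assume A: "\<forall>k<m. \<forall>i<n. \<bar>A k i\<bar> \<le> 1" and nz: "\<forall>i<n. \<exists>k<m. A k i \<noteq> 0"
    and \<epsilon>: "\<epsilon> > 0" and \<gamma>: "\<gamma> \<ge> 392000 * real n / \<epsilon>\<^sup>2" "\<gamma> \<ge> 1"
  let ?M = "spec_norm n (gram m A)"
  show "measure_pmf.prob (dimsum_coins m n A \<gamma>)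
             {\<omega>. spec_norm n (\<lambda>i j. DBD m A \<gamma> \<omega> i j - gram m A i j) / ?M \<le> \<epsilon>} \<ge> 1 / 2"
  proof (cases "n = 0")
    case True
    \<comment> \<open>Division by zero yields 0, so for n = 0 the quotient is 0 and the event is
      certain.\<close>
    then have "?M = 0" by (simp add: spec_norm_def)
    then show ?thesis using \<epsilon> by simp
  next
    case False
    then have n: "n > 0" by simp
    note main = dimsum_spec_norm_bound[OF n, of m A \<gamma>]
    have M: "?M > 0" using main(1) A nz \<gamma> by blast
    have "392000 * real n \<le> \<gamma> * \<epsilon>\<^sup>2" using \<gamma>(1) \<epsilon> by (simp add: field_simps)
    then have "392000 * real n * \<gamma> \<le> \<gamma> * \<epsilon>\<^sup>2 * \<gamma>" using \<gamma> by (intro mult_right_mono) auto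
    moreover have "(280 * sqrt (5 * real n * \<gamma>))\<^sup>2 = 392000 * real n * \<gamma>"
      using \<gamma>(2) by (simp add: power_mult_distrib)
    moreover have "\<gamma> * \<epsilon>\<^sup>2 * \<gamma> = (\<epsilon> * \<gamma>)\<^sup>2" by (simp add: power2_eq_square)
    ultimately have "(280 * sqrt (5 * real n * \<gamma>))\<^sup>2 \<le> (\<epsilon> * \<gamma>)\<^sup>2" by argo
    then have "280 * sqrt (5 * real n * \<gamma>) \<le> \<epsilon> * \<gamma>"
      by (rule power2_le_imp_le) (use \<epsilon> \<gamma> in auto)
    then have "?M / \<gamma> * (280 * sqrt (5 * real n * \<gamma>)) \<le> ?M / \<gamma> * (\<epsilon> * \<gamma>)"
      using M \<gamma> by (intro mult_left_mono) auto
    then have le: "?M / \<gamma> * (280 * sqrt (5 * real n * \<gamma>)) \<le> \<epsilon> * ?M"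
      using \<gamma> by (simp add: mult_ac)
    have "1 / 2 \<le> measure_pmf.prob (dimsum_coins m n A \<gamma>)
           {\<omega>. spec_norm n (\<lambda>i j. DBD m A \<gamma> \<omega> i j - gram m A i j)
                \<le> ?M / \<gamma> * (280 * sqrt (5 * real n * \<gamma>))}"
      using main(2) A nz \<gamma> by blast
    also have "\<dots> \<le> measure_pmf.prob (dimsum_coins m n A \<gamma>)
             {\<omega>. spec_norm n (\<lambda>i j. DBD m A \<gamma> \<omega> i j - gram m A i j) / ?M \<le> \<epsilon>}"
      by (rule measure_pmf.finite_measure_mono) (use le M in \<open>auto simp: pos_divide_le_eq\<close>)
    finally show ?thesis .
  qed
qed

end
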